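(* Let $\mathbb{Z}^+ = A \sqcup B$ be a partition with both $A$ and $B$ permutable. Then for every $a \in A$ and every integer $d \ge 1$, the set $\{k \ge 0 : a + 2^k d \in B\}$ is infinite; symmetrically, for every $b \in B$ and every integer $d \ge 1$, the set $\{k \ge 0 : b + 2^k d \in A\}$ is infinite.
   Context: $\mathbb{N} = \{1,2,3,\dots\} = \mathbb{Z}^+$. A set $S \subseteq \mathbb{Z}^+$ is permutable if there is a bijection $\pi\colon \mathbb{N} \to S$ such that no $i<j<k$ have $\pi(i),\pi(j),\pi(k)$ forming an arithmetic progression with $\pi(i)<\pi(j)<\pi(k)$ or $\pi(i)>\pi(j)>\pi(k)$. *)

theory Defs
  imports Main
begin

(* The positive integers are the elements of {1..} in type nat; 0 is excluded both
   as a position and as a value.  The progression condition is written with int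
   because subtraction on nat is truncated. *)

definition arith_prog3 :: "nat \<Rightarrow> nat \<Rightarrow> nat \<Rightarrow> bool" where
  "arith_prog3 x y z \<longleftrightarrow> int y - int x = int z - int y"

definition permutable :: "nat set \<Rightarrow> bool" where
  "permutable S \<longleftrightarrow> S \<subseteq> {1..} \<and>
     (\<exists>\<pi> :: nat \<Rightarrow> nat. bij_betw \<pi> {1..} S \<and>
        \<not> (\<exists>i j k. 1 \<le> i \<and> i < j \<and> j < k \<and> arith_prog3 (\<pi> i) (\<pi> j) (\<pi> k) \<and>
              (\<pi> i < \<pi> j \<and> \<pi> j < \<pi> k \<or> \<pi> i > \<pi> j \<and> \<pi> j > \<pi> k)))"

end

theory Submission
  imports Defs
begin

text \<open>
  If \<open>a + 2 ^ k * d\<close> stayed in the permutable set for all large \<open>k\<close>, then for large \<open>k\<close> these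
  values would also be placed after \<open>a\<close>. As \<open>a\<close>, \<open>a + 2 ^ k * d\<close>, \<open>a + 2 ^ (k + 1) * d\<close> is a
  progression, the third term must then be placed before the second, so the positions would
  decrease forever.
\<close>

lemma permutable_infinite_doubling_escapes:
  assumes S: "permutable S" and a: "a \<in> S" and d: "d \<ge> 1"
  shows "infinite {k::nat. a + 2 ^ k * d \<notin> S}"
proof
  assume fin: "finite {k::nat. a + 2 ^ k * d \<notin> S}"
  define v where "v k = a + 2 ^ k * d" for k :: nat
  from S obtain \<pi> :: "nat \<Rightarrow> nat" where bij: "bij_betw \<pi> {1..} S"
    and no_ap: "\<And>i j k. \<lbrakk>1 \<le> i; i < j; j < k; arith_prog3 (\<pi> i) (\<pi> j) (\<pi> k);
      \<pi> i < \<pi> j; \<pi> j < \<pi> k\<rbrakk> \<Longrightarrow> False"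
    unfolding permutable_def by blast
  define pos where "pos = inv_into {1..} \<pi>"
  have pos: "pos x \<ge> 1" "\<pi> (pos x) = x" if "x \<in> S" for x
    using that bij inv_into_into[of x \<pi> "{1..}"] f_inv_into_f[of x \<pi> "{1..}"]
    by (auto simp: pos_def bij_betw_def)
  have inj_v: "inj v"
    using d by (auto simp: inj_def v_def)
  \<comment> \<open>Finitely many values occupy positions up to \<open>pos a\<close>, and
    injectivity of \<open>v\<close> lets each come from at most one \<open>k\<close>. Position 0 is
    included; its arbitrary value \<open>\<pi> 0\<close> only enlarges a finite bound.\<close>
  have "finite (v -` \<pi> ` {..pos a})"
    by (intro finite_vimageI inj_v) simp
  moreover have "{k. v k \<in> S \<and> pos (v k) \<le> pos a} \<subseteq> v -` \<pi> ` {..pos a}"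
    using pos(2) by (force intro: image_eqI[OF sym])
  ultimately have "finite ({k. v k \<notin> S} \<union> {k. v k \<in> S \<and> pos (v k) \<le> pos a})"
    using fin by (auto simp: v_def intro: finite_subset)
  then obtain K where K: "\<And>k. k \<in> {k. v k \<notin> S} \<union> {k. v k \<in> S \<and> pos (v k) \<le> pos a} \<Longrightarrow> k < K"
    unfolding finite_nat_set_iff_bounded by blast
  have late: "v k \<in> S" "pos a < pos (v k)" if "k \<ge> K" for k
    using K[of k] that by force+
  have descent: "pos (v (Suc k)) < pos (v k)" if k: "k \<ge> K" for k
  proof (rule ccontr)
    have less: "a < v k" "v k < v (Suc k)"
      using d by (auto simp: v_def)
    have ap: "arith_prog3 a (v k) (v (Suc k))"
      by (simp add: arith_prog3_def v_def)
    assume "\<not> pos (v (Suc k)) < pos (v k)"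
    \<comment> \<open>Applying \<open>\<pi>\<close> to equal positions would give equal
      values.\<close>
    moreover have "pos (v (Suc k)) \<noteq> pos (v k)"
      using less(2) pos(2) late(1) k by (metis le_SucI less_irrefl)
    ultimately have "pos (v k) < pos (v (Suc k))"
      by simp
    then show False
      using no_ap[of "pos a" "pos (v k)" "pos (v (Suc k))"] less ap a late k pos by simp
  qed
  \<comment> \<open>Shifting by \<open>K\<close> turns the eventual descent into a chain indexed by
    all naturals.\<close>
  have "\<forall>n. (pos (v (K + Suc n)), pos (v (K + n))) \<in> less_than"
    using descent by simp
  then have "\<exists>f. \<forall>n. (f (Suc n), f n) \<in> less_than"
    by (rule exI[where x = "\<lambda>n. pos (v (K + n))"])
  then show False
    using wf_less_than unfolding wf_iff_no_infinite_down_chain by blast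
qed

theorem lemma9:
  fixes A B :: "nat set"
  assumes "A \<union> B = {1..}" and "A \<inter> B = {}"
    and "permutable A" and "permutable B"
  shows "(\<forall>a\<in>A. \<forall>d\<ge>1. infinite {k::nat. a + 2 ^ k * d \<in> B}) \<and>
         (\<forall>b\<in>B. \<forall>d\<ge>1. infinite {k::nat. b + 2 ^ k * d \<in> A})"
proof -
  have "x \<in> B \<longleftrightarrow> x \<notin> A" if "x \<ge> 1" for x
    using assms(1,2) that by auto
  \<comment> \<open>Here \<open>a\<close> may be any natural, even 0: \<open>d \<ge> 1\<close>
    already makes \<open>a + 2 ^ k * d\<close> positive, so it lies in exactly one of
    \<open>A\<close> and \<open>B\<close>.\<close>
  then have "{k::nat. a + 2 ^ k * d \<in> B} = {k. a + 2 ^ k * d \<notin> A}"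
    "{k::nat. a + 2 ^ k * d \<in> A} = {k. a + 2 ^ k * d \<notin> B}" if "d \<ge> 1" for a d
    using that by (auto simp: Suc_le_eq)
  then show ?thesis
    using permutable_infinite_doubling_escapes assms(3,4) by simp
qed

end
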